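(* Let $\Omega=\{X_1,\dots,X_k\}$ be a finite collection of discrete random variables, indexed by $\{1,\dots,k\}$, with joint distribution $\mathcal{P}_{\Omega}$, let $H$ be the associated entropy set function, and let $A,B\subseteq\{1,\dots,k\}$ be disjoint. With the six independence relations between $A$ and $B$ with respect to $H$ defined in the context, $$ModI \implies JI \implies MI \iff SMI \implies PI \quad\text{and}\quad ModI \implies SModI \implies MI .$$ Moreover, none of the following implications holds in general: $JI \Rightarrow ModI$, $SModI \Rightarrow ModI$, $JI \Rightarrow SModI$, $SModI \Rightarrow JI$, $MI \Rightarrow SModI$, $MI \Rightarrow JI$, $PI \Rightarrow MI$. That is, for each implication $P\Rightarrow Q$ in this list there exist a tuple $(\Omega,\mathcal{P}_{\Omega})$ and disjoint index sets $A,B$ such that $P$ holds and $Q$ fails for $A,B$ with respect to $H$.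
   Context: The random variables take values in finite alphabets. For an index set $A\subseteq\{1,\dots,k\}$, $X_A=\{X_a: a\in A\}$ and $H(A)=H(X_A)$ is the joint Shannon entropy of $X_A$ (with $H(\emptyset)=0$). Write $H(S|T)=H(S\cup T)-H(T)$ (conditional entropy). For disjoint $A,B$, the independence relations with respect to $H$ are: 1. $JI$ (joint independence): $H(A)+H(B)-H(A\cup B)=0$, equivalently $H(A|B)=H(A)$. 2. $MI$ (marginal independence): $H(\{a\}|B)=H(\{a\})$ for all $a\in A$, and $H(\{b\}|A)=H(\{b\})$ for all $b\in B$. 3. $PI$ (pairwise independence): $H(\{a\}|\{b\})=H(\{a\})$ and $H(\{b\}|\{a\})=H(\{b\})$ for all $a\in A$, $b\in B$. 4. $SMI$ (subset marginal independence): $H(\{a\}|X)=H(\{a\})$ for all $a\in A$, $X\subseteq B$, and $H(\{b\}|X)=H(\{b\})$ for all $b\in B$, $X\subseteq A$. 5. $ModI$ (modular independence): $H(\{j\}|X)=H(\{j\})$ for all $X\subseteq A\cup B$ and all $j\in (A\cup B)\setminus X$. 6. $SModI$ (subset modular independence): $H(\{j\}|X)=H(\{j\})$ for all $X$ with $X\subseteq A$ or $X\subseteq B$, and all $j\in (A\cup B)\setminus X$. *)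

theory Defs
  imports "HOL-Probability.Information"
begin

text \<open>
  The joint variable \<open>X\<^sub>A\<close> takes its values in the functions on the index set \<open>A\<close>
  (set to \<^term>\<open>undefined\<close> outside \<open>A\<close>).
\<close>

definition joint_rv :: "(nat \<Rightarrow> 'w \<Rightarrow> 'a) \<Rightarrow> nat set \<Rightarrow> 'w \<Rightarrow> (nat \<Rightarrow> 'a)" where
  "joint_rv X A = (\<lambda>\<omega>. restrict (\<lambda>i. X i \<omega>) A)"

text \<open>
  The library entropy with respect to counting measure on the range of \<open>X\<^sub>A\<close>, i.e. the
  expression that locale \<^locale>\<open>information_space\<close> writes as \<open>\<H>(joint_rv X A)\<close>;
  \<open>b\<close> is the base of the logarithm.
\<close>

definition entropy_fun :: "real \<Rightarrow> 'w measure \<Rightarrow> (nat \<Rightarrow> 'w \<Rightarrow> 'a) \<Rightarrow> nat set \<Rightarrow> real" where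
  "entropy_fun b M X A =
     prob_space.entropy M b (count_space (joint_rv X A ` space M)) (joint_rv X A)"

definition cond :: "(nat set \<Rightarrow> real) \<Rightarrow> nat set \<Rightarrow> nat set \<Rightarrow> real" where
  "cond H S T = H (S \<union> T) - H T"

text \<open>
  A random variable with finite alphabet is a simple function (measurable with finite range).
  The variables share the value type \<open>'a\<close>, but their ranges may differ.
\<close>

definition finite_rvs :: "'w measure \<Rightarrow> nat \<Rightarrow> (nat \<Rightarrow> 'w \<Rightarrow> 'a) \<Rightarrow> bool" where
  "finite_rvs M k X \<longleftrightarrow> prob_space M \<and> (\<forall>i\<in>{1..k}. simple_function M (X i))"

definition JI :: "(nat set \<Rightarrow> real) \<Rightarrow> nat set \<Rightarrow> nat set \<Rightarrow> bool" where
  "JI H A B \<longleftrightarrow> H A + H B - H (A \<union> B) = 0"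

definition MI :: "(nat set \<Rightarrow> real) \<Rightarrow> nat set \<Rightarrow> nat set \<Rightarrow> bool" where
  "MI H A B \<longleftrightarrow> (\<forall>a\<in>A. cond H {a} B = H {a}) \<and> (\<forall>b\<in>B. cond H {b} A = H {b})"

definition PI :: "(nat set \<Rightarrow> real) \<Rightarrow> nat set \<Rightarrow> nat set \<Rightarrow> bool" where
  "PI H A B \<longleftrightarrow> (\<forall>a\<in>A. \<forall>b\<in>B. cond H {a} {b} = H {a} \<and> cond H {b} {a} = H {b})"

definition SMI :: "(nat set \<Rightarrow> real) \<Rightarrow> nat set \<Rightarrow> nat set \<Rightarrow> bool" where
  "SMI H A B \<longleftrightarrow>
     (\<forall>a\<in>A. \<forall>Y\<subseteq>B. cond H {a} Y = H {a}) \<and> (\<forall>b\<in>B. \<forall>Y\<subseteq>A. cond H {b} Y = H {b})"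

definition ModI :: "(nat set \<Rightarrow> real) \<Rightarrow> nat set \<Rightarrow> nat set \<Rightarrow> bool" where
  "ModI H A B \<longleftrightarrow> (\<forall>Y\<subseteq>A \<union> B. \<forall>j\<in>(A \<union> B) - Y. cond H {j} Y = H {j})"

definition SModI :: "(nat set \<Rightarrow> real) \<Rightarrow> nat set \<Rightarrow> nat set \<Rightarrow> bool" where
  "SModI H A B \<longleftrightarrow>
     (\<forall>Y. Y \<subseteq> A \<or> Y \<subseteq> B \<longrightarrow> (\<forall>j\<in>(A \<union> B) - Y. cond H {j} Y = H {j}))"

lemma simple_function_joint_rv:
  assumes "finite_rvs M k X" "A \<subseteq> {1..k}"
  shows "simple_function M (joint_rv X A)"
proof -
  have fin: "finite A"
    using assms(2) finite_subset by blast
  have X: "simple_function M (X i)" if "i \<in> A" for i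
    using assms that unfolding finite_rvs_def by blast
  have "joint_rv X A ` space M \<subseteq> PiE A (\<lambda>i. X i ` space M)"
    unfolding joint_rv_def by auto
  moreover have "finite (PiE A (\<lambda>i. X i ` space M))"
    using fin X by (intro finite_PiE) (auto simp: simple_function_def)
  ultimately have "finite (joint_rv X A ` space M)"
    by (rule finite_subset)
  moreover have "joint_rv X A -` {f} \<inter> space M \<in> sets M"
    if "f \<in> joint_rv X A ` space M" for f
  proof -
    have ext: "f \<in> extensional A"
      using that unfolding joint_rv_def by auto
    have "joint_rv X A -` {f} \<inter> space M = {\<omega> \<in> space M. \<forall>i\<in>A. X i \<omega> = f i}"
      using ext unfolding joint_rv_def by (auto simp: fun_eq_iff extensional_def)
    also have "\<dots> \<in> sets M"
    proof (rule sets.sets_Collect_finite_All[OF _ fin])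
      fix i assume "i \<in> A"
      then have "X i -` {f i} \<inter> space M \<in> sets M"
        by (rule simple_functionD(2)[OF X])
      then show "{\<omega> \<in> space M. X i \<omega> = f i} \<in> sets M"
        by (simp add: vimage_def Int_def conj_commute)
    qed
    finally show ?thesis .
  qed
  ultimately show ?thesis
    unfolding simple_function_def by blast
qed

lemma entropy_fun_eq_sum:
  assumes "1 < b" "finite_rvs M k X" "A \<subseteq> {1..k}"
  shows "entropy_fun b M X A =
    - (\<Sum>f\<in>joint_rv X A ` space M.
         measure M (joint_rv X A -` {f} \<inter> space M) *
         log b (measure M (joint_rv X A -` {f} \<inter> space M)))"
proof -
  interpret prob_space M
    using assms(2) unfolding finite_rvs_def by blast
  interpret information_space M b
    by unfold_locales (rule assms(1))
  show ?thesis
    unfolding entropy_fun_def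
    by (rule entropy_simple_distributed[OF simple_distributedI])
       (use simple_function_joint_rv[OF assms(2,3)] in auto)
qed

lemma entropy_fun_empty:
  assumes "1 < b" "finite_rvs M k X"
  shows "entropy_fun b M X {} = 0"
proof -
  interpret prob_space M
    using assms(2) unfolding finite_rvs_def by blast
  have im: "joint_rv X {} ` space M = {\<lambda>_. undefined}"
    using not_empty unfolding joint_rv_def restrict_def by auto
  have vi: "joint_rv X {} -` {\<lambda>_. undefined} \<inter> space M = space M"
    unfolding joint_rv_def restrict_def by auto
  show ?thesis
    by (subst entropy_fun_eq_sum[OF assms]) (auto simp: im vi prob_space)
qed

end

theory Submission
  imports Defs
begin

text \<open>
  The conditional mutual information of \<open>X\<close> and \<open>Y\<close> given \<open>Z\<close> is nonnegative, so entropy is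
  a submodular set function vanishing on the empty set; these two properties alone give all the
  implications. The failures are caused by duplicated variables and by parity bits:
  the parity of two (three) independent bits is independent of any one (two) of them,
  but is determined by all of them.
\<close>

section \<open>Submodularity of entropy\<close>

text \<open>Each fibre of \<open>f \<circ> W\<close> is a disjoint union of fibres of
  \<open>W\<close>. Indexing the entropies of several functions of \<open>W\<close> by the same
  values \<open>w\<close> lets them be combined term by term.\<close>

lemma (in information_space) entropy_compose_eq_sum:
  assumes W: "simple_function M W"
  shows "\<H>(f \<circ> W) = - (\<Sum>w\<in>W ` space M.
    prob (W -` {w} \<inter> space M) * log b (prob ((f \<circ> W) -` {f w} \<inter> space M)))"
proof -
  note fW = simple_function_compose[OF W, of f]
  have fin: "finite (W ` space M)"
    using W by (rule simple_functionD)
  have prob_sum: "prob ((f \<circ> W) -` {v} \<inter> space M) =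
    (\<Sum>w\<in>{w\<in>W ` space M. f w = v}. prob (W -` {w} \<inter> space M))" for v
  proof -
    have "(f \<circ> W) -` {v} \<inter> space M = (\<Union>w\<in>{w\<in>W ` space M. f w = v}. W -` {w} \<inter> space M)"
      by auto
    moreover have "prob \<dots> = (\<Sum>w\<in>{w\<in>W ` space M. f w = v}. prob (W -` {w} \<inter> space M))"
      using fin simple_functionD(2)[OF W]
      by (intro finite_measure_finite_Union) (auto simp: disjoint_family_on_def)
    ultimately show ?thesis
      by simp
  qed
  have "\<H>(f \<circ> W) = - (\<Sum>v\<in>f ` W ` space M.
      prob ((f \<circ> W) -` {v} \<inter> space M) * log b (prob ((f \<circ> W) -` {v} \<inter> space M)))"
    using entropy_simple_distributed[OF simple_distributedI[OF fW measure_nonneg refl]]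
    by (simp add: image_comp)
  also have "\<dots> = - (\<Sum>v\<in>f ` W ` space M. \<Sum>w\<in>{w\<in>W ` space M. f w = v}.
      prob (W -` {w} \<inter> space M) * log b (prob ((f \<circ> W) -` {f w} \<inter> space M)))"
    by (subst (1) prob_sum) (simp add: sum_distrib_right)
  also have "\<dots> = - (\<Sum>w\<in>W ` space M.
      prob (W -` {w} \<inter> space M) * log b (prob ((f \<circ> W) -` {f w} \<inter> space M)))"
    using fin by (subst sum.group) auto
  finally show ?thesis .
qed

text \<open>All four entropies are written over the values of the triple \<open>?W\<close>; the
  identity is then the expansion of the logarithm of a quotient in each term.\<close>

lemma (in information_space) conditional_mutual_information_eq_entropy:
  assumes X: "simple_function M X" and Y: "simple_function M Y" and Z: "simple_function M Z"
  shows "\<I>(X ; Y | Z) = \<H>(\<lambda>x. (X x, Z x)) + \<H>(\<lambda>x. (Y x, Z x))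
    - \<H>(\<lambda>x. (X x, Y x, Z x)) - \<H>(Z)"
proof -
  let ?W = "\<lambda>x. (X x, Y x, Z x)"
  have W: "simple_function M ?W"
    by (intro simple_function_Pair X Y Z)
  let ?p = "\<lambda>f w. prob ((f \<circ> ?W) -` {f w} \<inter> space M)"
  let ?xz = "\<lambda>(x, y, z). (x, z)" and ?yz = "\<lambda>(x, y, z). (y, z)" and ?z = "\<lambda>(x, y, z). z"
  \<comment> \<open>If the factor \<open>?p id w\<close> is zero, both sides vanish whatever the
    logarithms are. Otherwise the marginal probabilities are at least as large, so every logarithm
    has a positive argument and the quotient splits.\<close>
  have *: "?p id w * log b (?p id w / (?p ?xz w * (?p ?yz w / ?p ?z w))) =
      ?p id w * log b (?p id w) + ?p id w * log b (?p ?z w)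
      - ?p id w * log b (?p ?xz w) - ?p id w * log b (?p ?yz w)" for w
  proof (cases "?p id w = 0")
    case False
    then have pos: "0 < ?p id w"
      by (simp add: zero_less_measure_iff)
    have "0 < ?p ?xz w" "0 < ?p ?yz w" "0 < ?p ?z w"
      by (rule less_le_trans[OF pos],
          intro finite_measure_mono simple_functionD(2)[OF simple_function_compose[OF W]], auto)+
    with pos show ?thesis
      by (simp add: log_divide log_mult algebra_simps)
  qed simp
  have "\<I>(X ; Y | Z) =
    (\<Sum>w\<in>?W ` space M. ?p id w * log b (?p id w / (?p ?xz w * (?p ?yz w / ?p ?z w))))"
    by (subst conditional_mutual_information_eq[OF
          simple_distributedI[OF Z measure_nonneg refl]
          simple_distributedI[OF simple_function_Pair[OF Y Z] measure_nonneg refl]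
          simple_distributedI[OF simple_function_Pair[OF X Z] measure_nonneg refl]
          simple_distributedI[OF W measure_nonneg refl]])
      (auto intro!: sum.cong simp: comp_def)
  also have "\<dots> = \<H>(?xz \<circ> ?W) + \<H>(?yz \<circ> ?W) - \<H>(id \<circ> ?W) - \<H>(?z \<circ> ?W)"
    unfolding * entropy_compose_eq_sum[OF W]
    by (simp add: sum.distrib sum_subtractf)
  finally show ?thesis
    by (simp add: comp_def)
qed

lemma (in information_space) entropy_submodular:
  assumes "simple_function M X" "simple_function M Y" "simple_function M Z"
  shows "\<H>(\<lambda>x. (X x, Y x, Z x)) + \<H>(Z) \<le> \<H>(\<lambda>x. (X x, Z x)) + \<H>(\<lambda>x. (Y x, Z x))"
  using conditional_mutual_information_nonneg[OF assms]
    conditional_mutual_information_eq_entropy[OF assms] by simp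

text \<open>The inequality for triples is applied to the joint variables of \<open>S\<close> and
  \<open>T\<close> given that of \<open>S \<inter> T\<close>. The resulting tuples are injective
  images of the joint variables of \<open>S\<close>, \<open>T\<close> and
  \<open>S \<union> T\<close>, and injections preserve entropy.\<close>

lemma entropy_fun_submodular:
  assumes "1 < b" "finite_rvs M k X" "S \<subseteq> {1..k}" "T \<subseteq> {1..k}"
  shows "entropy_fun b M X (S \<union> T) + entropy_fun b M X (S \<inter> T)
    \<le> entropy_fun b M X S + entropy_fun b M X T"
proof -
  interpret prob_space M
    using assms(2) unfolding finite_rvs_def by blast
  interpret information_space M b
    by unfold_locales (rule assms(1))
  let ?J = "joint_rv X"
  have sf: "simple_function M (?J A)" if "A \<subseteq> {1..k}" for A
    by (rule simple_function_joint_rv[OF assms(2) that])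
  have ST: "S \<union> T \<subseteq> {1..k}" "S \<inter> T \<subseteq> {1..k}"
    using assms(3,4) by auto
  have J: "restrict (?J A w) B = ?J B w" if "B \<subseteq> A" for A B w
    using that unfolding joint_rv_def by (auto simp: fun_eq_iff)
  have "\<H>((\<lambda>r. (r, restrict r (S \<inter> T))) \<circ> ?J S) = \<H>(?J S)"
    by (intro entropy_of_inj sf assms) (auto simp: inj_on_def)
  then have S: "\<H>(\<lambda>w. (?J S w, ?J (S \<inter> T) w)) = \<H>(?J S)"
    by (simp add: comp_def J)
  have "\<H>((\<lambda>r. (r, restrict r (S \<inter> T))) \<circ> ?J T) = \<H>(?J T)"
    by (intro entropy_of_inj sf assms) (auto simp: inj_on_def)
  then have T: "\<H>(\<lambda>w. (?J T w, ?J (S \<inter> T) w)) = \<H>(?J T)"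
    by (simp add: comp_def J)
  \<comment> \<open>Injective because an extensional function on \<open>S \<union> T\<close> is
    determined by its restrictions to \<open>S\<close> and \<open>T\<close>.\<close>
  have "\<H>((\<lambda>r. (restrict r S, restrict r T, restrict r (S \<inter> T))) \<circ> ?J (S \<union> T)) = \<H>(?J (S \<union> T))"
  proof (intro entropy_of_inj sf ST inj_onI)
    fix r r'
    assume "r \<in> ?J (S \<union> T) ` space M" "r' \<in> ?J (S \<union> T) ` space M"
      and eq: "(restrict r S, restrict r T, restrict r (S \<inter> T)) =
        (restrict r' S, restrict r' T, restrict r' (S \<inter> T))"
    then have ext: "r \<in> extensional (S \<union> T)" "r' \<in> extensional (S \<union> T)"
      by (auto simp: joint_rv_def)
    show "r = r'"
    proof (rule extensionalityI[OF ext])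
      show "r i = r' i" if "i \<in> S \<union> T" for i
        using that eq by (metis Un_iff prod.inject restrict_apply')
    qed
  qed
  then have U: "\<H>(\<lambda>w. (?J S w, ?J T w, ?J (S \<inter> T) w)) = \<H>(?J (S \<union> T))"
    by (simp add: comp_def J le_infI1)
  show ?thesis
    using entropy_submodular[OF sf[OF assms(3)] sf[OF assms(4)] sf[OF ST(2)]]
    unfolding entropy_fun_def S T U by simp
qed

section \<open>Implications for submodular set functions\<close>

locale submodular_fun =
  fixes H :: "nat set \<Rightarrow> real" and k :: nat
  assumes empty: "H {} = 0"
    and submodular: "S \<subseteq> {1..k} \<Longrightarrow> T \<subseteq> {1..k} \<Longrightarrow> H (S \<union> T) + H (S \<inter> T) \<le> H S + H T"
begin

lemma subadditive:
  assumes "S \<subseteq> {1..k}" "T \<subseteq> {1..k}" "S \<inter> T = {}"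
  shows "H (S \<union> T) \<le> H S + H T"
  using submodular[OF assms(1,2)] assms(3) empty by simp

text \<open>A squeeze: submodularity at \<open>S \<union> T'\<close> and \<open>T\<close> gives
  \<open>cond H S T \<le> cond H S T'\<close>, subadditivity gives
  \<open>cond H S T' \<le> H S\<close>, and the outer terms agree.\<close>

lemma cond_eq_mono:
  assumes "S \<subseteq> {1..k}" "T \<subseteq> {1..k}" "S \<inter> T = {}" "T' \<subseteq> T" "cond H S T = H S"
  shows "cond H S T' = H S"
proof -
  have "H (S \<union> T' \<union> T) + H ((S \<union> T') \<inter> T) \<le> H (S \<union> T') + H T"
    using assms by (intro submodular) auto
  moreover have "S \<union> T' \<union> T = S \<union> T" "(S \<union> T') \<inter> T = T'"
    using assms by auto
  moreover have "H (S \<union> T') \<le> H S + H T'"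
    using assms by (intro subadditive) auto
  ultimately show ?thesis
    using assms(5) unfolding cond_def by simp
qed

text \<open>Both sides say \<open>H (S \<union> T) = H S + H T\<close>.\<close>

lemma cond_eq_sym: "cond H S T = H S \<longleftrightarrow> cond H T S = H T"
  unfolding cond_def by (auto simp: Un_commute)

text \<open>\<open>cond_eq_mono\<close> shrinks only the conditioning set, so symmetry first moves
  the singleton there; the full set \<open>A\<close> or \<open>B\<close> is then cut down to
  it.\<close>

lemma JI_imp_MI:
  assumes "A \<subseteq> {1..k}" "B \<subseteq> {1..k}" "A \<inter> B = {}" "JI H A B"
  shows "MI H A B"
proof -
  have AB: "cond H A B = H A" and BA: "cond H B A = H B"
    using assms(4) by (auto simp: JI_def cond_def Un_commute)
  have "cond H {a} B = H {a}" if "a \<in> A" for a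
    by (subst cond_eq_sym) (use assms that in \<open>intro cond_eq_mono[OF _ _ _ _ BA], auto\<close>)
  moreover have "cond H {b} A = H {b}" if "b \<in> B" for b
    by (subst cond_eq_sym) (use assms that in \<open>intro cond_eq_mono[OF _ _ _ _ AB], auto\<close>)
  ultimately show ?thesis
    unfolding MI_def by blast
qed

text \<open>Forwards, the conditioning set shrinks by \<open>cond_eq_mono\<close>; backwards,
  \<open>Y\<close> is taken to be all of \<open>B\<close> or \<open>A\<close>.\<close>

lemma MI_iff_SMI:
  assumes "A \<subseteq> {1..k}" "B \<subseteq> {1..k}" "A \<inter> B = {}"
  shows "MI H A B \<longleftrightarrow> SMI H A B"
proof
  assume MI: "MI H A B"
  have "cond H {a} Y = H {a}" if "a \<in> A" "Y \<subseteq> B" for a Y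
    using MI assms that by (intro cond_eq_mono[of "{a}" B Y]) (auto simp: MI_def)
  moreover have "cond H {b} Y = H {b}" if "b \<in> B" "Y \<subseteq> A" for b Y
    using MI assms that by (intro cond_eq_mono[of "{b}" A Y]) (auto simp: MI_def)
  ultimately show "SMI H A B"
    unfolding SMI_def by blast
next
  assume "SMI H A B"
  then show "MI H A B"
    unfolding SMI_def MI_def by blast
qed

text \<open>Chain rule: building \<open>Y\<close> one element at a time, each new \<open>j\<close>
  contributes exactly \<open>H {j}\<close>.\<close>

lemma ModI_imp_sum:
  assumes "A \<subseteq> {1..k}" "B \<subseteq> {1..k}" "ModI H A B" "Y \<subseteq> A \<union> B"
  shows "H Y = (\<Sum>j\<in>Y. H {j})"
proof -
  have "finite Y"
    using assms by (meson Un_least finite_atLeastAtMost finite_subset)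
  then show ?thesis
    using assms(4)
  proof (induction Y)
    case (insert j Y)
    then have "cond H {j} Y = H {j}"
      using assms(3) unfolding ModI_def by blast
    with insert show ?case
      by (simp add: cond_def)
  qed (simp add: empty)
qed

lemma ModI_imp_JI:
  assumes "A \<subseteq> {1..k}" "B \<subseteq> {1..k}" "A \<inter> B = {}" "ModI H A B"
  shows "JI H A B"
proof -
  have "finite A" "finite B"
    using assms finite_subset by blast+
  then have "(\<Sum>j\<in>A \<union> B. H {j}) = (\<Sum>j\<in>A. H {j}) + (\<Sum>j\<in>B. H {j})"
    using assms(3) by (rule sum.union_disjoint)
  moreover note ModI_imp_sum[OF assms(1,2,4), of A] ModI_imp_sum[OF assms(1,2,4), of B]
    ModI_imp_sum[OF assms(1,2,4), of "A \<union> B"]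
  ultimately show ?thesis
    unfolding JI_def by simp
qed

end

lemma submodular_fun_entropy_fun:
  assumes "1 < b" "finite_rvs M k X"
  shows "submodular_fun (entropy_fun b M X) k"
  using entropy_fun_empty[OF assms] entropy_fun_submodular[OF assms]
  by (rule submodular_fun.intro)

lemma SMI_imp_PI: "SMI H A B \<Longrightarrow> PI H A B"
  unfolding SMI_def PI_def by (meson empty_subsetI insert_subset)

lemma ModI_imp_SModI: "ModI H A B \<Longrightarrow> SModI H A B"
  unfolding ModI_def SModI_def by (meson le_supI1 le_supI2)

text \<open>Take the conditioning set to be \<open>B\<close> or \<open>A\<close>; disjointness puts
  the elements of the other set outside it.\<close>

lemma SModI_imp_MI: "A \<inter> B = {} \<Longrightarrow> SModI H A B \<Longrightarrow> MI H A B"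
  unfolding SModI_def MI_def by blast

section \<open>Counterexamples from three fair bits\<close>

text \<open>
  The counterexamples live on a single uniform space of three independent fair bits; variables 4,
  5 and 6 are the parity of all three bits, a copy of the first bit, and the parity of the first two.
\<close>

definition bits :: "nat \<Rightarrow> nat \<Rightarrow> nat" where
  "bits i w =
    [0, w mod 2, w div 2 mod 2, w div 4 mod 2,
     (w mod 2 + w div 2 mod 2 + w div 4 mod 2) mod 2,
     w mod 2, (w mod 2 + w div 2 mod 2) mod 2] ! i"

definition bits_space :: "nat measure" where
  "bits_space = uniform_count_measure {..<8}"

lemma finite_rvs_bits: "finite_rvs bits_space 6 bits"
  unfolding finite_rvs_def bits_space_def
  by (auto simp: simple_function_def space_uniform_count_measure sets_uniform_count_measure
      lessThan_empty_iff intro!: prob_space_uniform_count_measure)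

text \<open>Fibres of equal size \<open>c\<close> make the joint variable uniform on its range, so
  every value has probability \<open>c / card \<Omega>\<close>.\<close>

lemma entropy_fun_uniform:
  fixes \<Omega> :: "'w set"
  assumes b: "1 < b" and \<Omega>: "finite \<Omega>" "\<Omega> \<noteq> {}" and A: "A \<subseteq> {1..k}"
    and rvs: "finite_rvs (uniform_count_measure \<Omega>) k X"
    and card: "\<And>w. w \<in> \<Omega> \<Longrightarrow> card {v\<in>\<Omega>. \<forall>i\<in>A. X i v = X i w} = c"
  shows "entropy_fun b (uniform_count_measure \<Omega>) X A = log b (card \<Omega> / c)"
proof -
  let ?M = "uniform_count_measure \<Omega>"
  interpret prob_space ?M
    using rvs unfolding finite_rvs_def by blast
  let ?p = "\<lambda>f. measure ?M (joint_rv X A -` {f} \<inter> space ?M)"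
  have sf: "simple_function ?M (joint_rv X A)"
    by (rule simple_function_joint_rv[OF rvs A])
  have p: "?p f = c / card \<Omega>" if f: "f \<in> joint_rv X A ` space ?M" for f
  proof -
    obtain w where w: "w \<in> \<Omega>" "f = joint_rv X A w"
      using f by (auto simp: space_uniform_count_measure)
    have "joint_rv X A -` {f} \<inter> space ?M = {v\<in>\<Omega>. \<forall>i\<in>A. X i v = X i w}"
      unfolding w(2) joint_rv_def space_uniform_count_measure
      by (auto simp: fun_eq_iff restrict_def split: if_splits)
    then show ?thesis
      using card[OF w(1)] \<Omega>(1) by (simp add: measure_uniform_count_measure)
  qed
  have "(\<Sum>f\<in>joint_rv X A ` space ?M. ?p f) =
      prob (\<Union>f\<in>joint_rv X A ` space ?M. joint_rv X A -` {f} \<inter> space ?M)"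
    using sf by (intro finite_measure_finite_Union[symmetric])
      (auto simp: disjoint_family_on_def simple_function_def)
  also have "(\<Union>f\<in>joint_rv X A ` space ?M. joint_rv X A -` {f} \<inter> space ?M) = space ?M"
    by auto
  finally have one: "(\<Sum>f\<in>joint_rv X A ` space ?M. ?p f) = 1"
    by (simp add: prob_space)
  \<comment> \<open>Needed to invert the quotient inside the logarithm at the end.\<close>
  have "c \<noteq> 0"
  proof
    assume "c = 0"
    then have "(\<Sum>f\<in>joint_rv X A ` space ?M. ?p f) = 0"
      using p by (intro sum.neutral) auto
    with one show False by simp
  qed
  have "entropy_fun b ?M X A = - (\<Sum>f\<in>joint_rv X A ` space ?M. ?p f * log b (?p f))"
    by (rule entropy_fun_eq_sum[OF b rvs A])
  also have "\<dots> = - (\<Sum>f\<in>joint_rv X A ` space ?M. ?p f * log b (c / card \<Omega>))"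
    using p by (intro arg_cong[where f=uminus] sum.cong) auto
  also have "\<dots> = - log b (c / card \<Omega>)"
    using one by (simp add: sum_distrib_right[symmetric])
  also have "\<dots> = log b (card \<Omega> / c)"
    using \<open>c \<noteq> 0\<close> \<Omega> by (simp add: log_divide)
  finally show ?thesis .
qed

text \<open>
  A pair \<open>(is, n)\<close> records that the variables indexed by \<open>is\<close>, as linear forms in the three
  bits, have rank \<open>n\<close>, so that their joint entropy is \<open>n\<close> bits.
\<close>

definition bits_ranks :: "(nat list \<times> nat) list" where
  "bits_ranks =
    [([], 0), ([1], 1), ([2], 1), ([3], 1), ([4], 1),
     ([1, 2], 2), ([1, 3], 2), ([1, 4], 2), ([2, 3], 2), ([2, 4], 2),
     ([3, 4], 2), ([1, 2, 3], 3), ([1, 2, 4], 3), ([1, 3, 4], 3), ([2, 3, 4], 3),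
     ([1, 2, 3, 4], 3), ([5], 1), ([1, 5], 1), ([6], 1), ([1, 6], 2),
     ([2, 6], 2), ([1, 2, 6], 2)]"

text \<open>A form that evaluation can decide: lists replace sets, and multiplying by
  \<open>2 ^ n\<close> avoids a division. A rank of \<open>n\<close> means fibres of
  \<open>2 ^ (3 - n)\<close> points.\<close>

lemma bits_fibres:
  "\<forall>(is, n)\<in>set bits_ranks. set is \<subseteq> {1..6} \<and> n \<le> 3 \<and> (\<forall>w\<in>set [0..<8].
     length (filter (\<lambda>v. \<forall>i\<in>set is. bits i v = bits i w) [0..<8]) * 2 ^ n = 8)"
  by code_simp

lemma entropy_fun_bits:
  assumes b: "1 < b" and "is": "(is, n) \<in> set bits_ranks"
  shows "entropy_fun b bits_space bits (set is) = n * log b 2"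
proof -
  have A: "set is \<subseteq> {1..6}" and n: "n \<le> 3"
    and fibres: "\<And>w. w < 8 \<Longrightarrow>
      length (filter (\<lambda>v. \<forall>i\<in>set is. bits i v = bits i w) [0..<8]) * 2 ^ n = 8"
    using bspec[OF bits_fibres "is"] by auto
  have "card {v\<in>{..<8}. \<forall>i\<in>set is. bits i v = bits i w} = 2 ^ (3 - n)" if "w \<in> {..<8}" for w
  proof -
    have "card {v\<in>{..<8}. \<forall>i\<in>set is. bits i v = bits i w} =
      length (filter (\<lambda>v. \<forall>i\<in>set is. bits i v = bits i w) [0..<8])" (is "?c = _")
      by (subst distinct_card[symmetric]) (auto intro!: arg_cong[where f=card])
    then have "?c * 2 ^ n = 2 ^ (3 - n) * 2 ^ n"
      using fibres that n by (simp add: power_add[symmetric])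
    then show ?thesis by simp
  qed
  then have "entropy_fun b bits_space bits (set is) = log b (card {..<8::nat} / (2 ^ (3 - n) :: nat))"
    unfolding bits_space_def
    using finite_rvs_bits
    by (intro entropy_fun_uniform[OF b _ _ A]) (auto simp: bits_space_def lessThan_empty_iff)
  also have "real (card {..<8::nat}) / (2 ^ (3 - n) :: nat) = 2 ^ n"
    using n power_add[of "2::real" n "3 - n"] by (simp add: field_simps)
  finally show ?thesis
    using b by (simp add: log_nat_power)
qed

text \<open>Turns the quantifier over conditioning sets in \<open>SModI\<close> into finitely many
  cases, all covered by \<open>bits_ranks\<close>.\<close>

lemma subset_doubleton_iff: "Y \<subseteq> {a, b} \<longleftrightarrow> Y \<in> {{}, {a}, {b}, {a, b}}"
  by auto

context
  fixes b :: real and H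
  assumes b: "1 < b"
  defines "H \<equiv> entropy_fun b bits_space bits"
begin

private lemma log2_pos: "log b 2 > 0"
  using b by simp

private lemma ranks_H: "\<forall>(is, n)\<in>set bits_ranks. H (set is) = real n * log b 2"
  using entropy_fun_bits[OF b] unfolding H_def by blast

private lemmas values_H = ranks_H[unfolded bits_ranks_def, simplified]

text \<open>With the second set empty, \<open>JI\<close> and \<open>MI\<close> reduce to
  \<open>H {} = 0\<close>, whereas \<open>SModI\<close> also sees the dependence inside the first
  set: variable 5 is a copy of variable 1.\<close>

lemma bits_copy: "JI H {1, 5} {}" "MI H {1, 5} {}" "\<not> SModI H {1, 5} {}"
proof -
  show "JI H {1, 5} {}" "MI H {1, 5} {}"
    using values_H by (simp_all add: JI_def MI_def cond_def)
  have "cond H {5} {1} \<noteq> H {5}"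
    using values_H log2_pos by (simp add: cond_def insert_commute)
  then show "\<not> SModI H {1, 5} {}"
    unfolding SModI_def by (auto intro!: exI[of _ "{1}"])
qed

text \<open>Any three of the four variables are independent, which suffices for conditioning sets of
  at most two elements; but all four have rank 3, less than 2 + 2.\<close>

lemma bits_parity3: "SModI H {1, 2} {3, 4}" "\<not> JI H {1, 2} {3, 4}"
proof -
  show "SModI H {1, 2} {3, 4}"
    using values_H unfolding SModI_def cond_def subset_doubleton_iff
    by (auto simp: insert_commute)
  show "\<not> JI H {1, 2} {3, 4}"
    using values_H log2_pos by (simp add: JI_def insert_commute)
qed

text \<open>Variable 6 is independent of each of the first two bits but has conditional entropy 0
  given both.\<close>

lemma bits_parity2: "PI H {1, 2} {6}" "\<not> MI H {1, 2} {6}"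
  using values_H log2_pos by (auto simp: PI_def MI_def cond_def insert_commute)

end

theorem mainTheorem3:
  fixes b :: real
  assumes "1 < b"
  shows
    "(\<forall>(M :: 'w measure) (X :: nat \<Rightarrow> 'w \<Rightarrow> 'a) k A B.
        finite_rvs M k X \<and> A \<subseteq> {1..k} \<and> B \<subseteq> {1..k} \<and> A \<inter> B = {} \<longrightarrow>
        (let H = entropy_fun b M X in
           (ModI H A B \<longrightarrow> JI H A B) \<and>
           (JI H A B \<longrightarrow> MI H A B) \<and>
           (MI H A B \<longleftrightarrow> SMI H A B) \<and>
           (SMI H A B \<longrightarrow> PI H A B) \<and>
           (ModI H A B \<longrightarrow> SModI H A B) \<and>
           (SModI H A B \<longrightarrow> MI H A B))) \<and>
     (\<forall>(P, Q) \<in> {(JI, ModI), (SModI, ModI), (JI, SModI), (SModI, JI),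
                  (MI, SModI), (MI, JI), (PI, MI)}.
        \<exists>(M :: nat measure) (X :: nat \<Rightarrow> nat \<Rightarrow> nat) k A B.
          finite_rvs M k X \<and> A \<subseteq> {1..k} \<and> B \<subseteq> {1..k} \<and> A \<inter> B = {} \<and>
          P (entropy_fun b M X) A B \<and> \<not> Q (entropy_fun b M X) A B)"
proof (intro conjI allI impI)
  fix M :: "'w measure" and X :: "nat \<Rightarrow> 'w \<Rightarrow> 'a" and k A B
  assume *: "finite_rvs M k X \<and> A \<subseteq> {1..k} \<and> B \<subseteq> {1..k} \<and> A \<inter> B = {}"
  interpret submodular_fun "entropy_fun b M X" k
    using submodular_fun_entropy_fun[OF assms] * by blast
  show "let H = entropy_fun b M X in
      (ModI H A B \<longrightarrow> JI H A B) \<and> (JI H A B \<longrightarrow> MI H A B) \<and>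
      (MI H A B \<longleftrightarrow> SMI H A B) \<and> (SMI H A B \<longrightarrow> PI H A B) \<and>
      (ModI H A B \<longrightarrow> SModI H A B) \<and> (SModI H A B \<longrightarrow> MI H A B)"
    using * ModI_imp_JI[of A B] JI_imp_MI[of A B] MI_iff_SMI[of A B] SMI_imp_PI[of _ A B]
      ModI_imp_SModI[of _ A B] SModI_imp_MI[of A B]
    unfolding Let_def by blast
next
  let ?H = "entropy_fun b bits_space bits"
  let ?ex = "\<lambda>P Q. \<exists>(M :: nat measure) (X :: nat \<Rightarrow> nat \<Rightarrow> nat) k A B.
      finite_rvs M k X \<and> A \<subseteq> {1..k} \<and> B \<subseteq> {1..k} \<and> A \<inter> B = {} \<and>
      P (entropy_fun b M X) A B \<and> \<not> Q (entropy_fun b M X) A B"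
  have ex: "?ex P Q"
    if "P ?H A B" "\<not> Q ?H A B" "A \<subseteq> {1..6}" "B \<subseteq> {1..6}" "A \<inter> B = {}" for P Q A B
    using that finite_rvs_bits by blast
  note copy = bits_copy[OF assms] and parity3 = bits_parity3[OF assms]
    and parity2 = bits_parity2[OF assms]
  have not_ModI: "\<not> ModI ?H A B" if "\<not> SModI ?H A B" for A B
    using that ModI_imp_SModI by blast
  interpret submodular_fun ?H 6
    by (rule submodular_fun_entropy_fun[OF assms finite_rvs_bits])
  \<comment> \<open>Three examples serve all seven cases. The implications already proved transfer
    them: failure of \<open>SModI\<close> or \<open>JI\<close> refutes \<open>ModI\<close>, and
    \<open>SModI\<close> supplies \<open>MI\<close>.\<close>
  have "?ex JI ModI"
    using copy not_ModI by (intro ex[of _ "{1, 5}" "{}"]) auto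
  moreover have "?ex SModI ModI"
    using parity3 ModI_imp_JI[of "{1, 2}" "{3, 4}"] by (intro ex[of _ "{1, 2}" "{3, 4}"]) auto
  moreover have "?ex JI SModI"
    using copy by (intro ex[of _ "{1, 5}" "{}"]) auto
  moreover have "?ex SModI JI"
    using parity3 by (intro ex[of _ "{1, 2}" "{3, 4}"]) auto
  moreover have "?ex MI SModI"
    using copy by (intro ex[of _ "{1, 5}" "{}"]) auto
  moreover have "?ex MI JI"
    using parity3 by (intro ex[of _ "{1, 2}" "{3, 4}"] SModI_imp_MI) auto
  moreover have "?ex PI MI"
    using parity2 by (intro ex[of _ "{1, 2}" "{6}"]) auto
  ultimately show "\<forall>(P, Q) \<in> {(JI, ModI), (SModI, ModI), (JI, SModI), (SModI, JI),
                  (MI, SModI), (MI, JI), (PI, MI)}. ?ex P Q"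
    by simp
qed

end
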